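(* For every voting rule $\mathcal{E}$, $\mathcal{E}$-Conformant Bribery polynomial-time many-one reduces to $\mathcal{E}$-Control by Replacing Voters.
   Context: An election $(C,V)$ consists of a finite set of candidates $C$ and a finite collection (multiset, listed explicitly) of voters $V$; each voter has a vote, which is a strict total order over $C$. A voting rule $\mathcal{E}$ maps each election to a subset of its candidate set, the $\mathcal{E}$-winners. $\mathcal{E}$-Conformant Bribery. Given: an election $(C,V)$, a bribe limit $k\ge 0$, and a preferred candidate $p\in C$. Question: does there exist a way to set the votes of a subcollection of at most $k$ voters in $V$ to votes that occur in (the original) $V$ such that $p$ is an $\mathcal{E}$-winner of the resulting election? $\mathcal{E}$-Control by Replacing Voters. Given: an election $(C,V)$ ($V$ are the registered voters), a collection $U$ of unregistered voters with votes over $C$, an integer $k\ge 0$, and a preferred candidate $p\in C$. Question: do there exist subcollections $V'\subseteq V$ and $U'\subseteq U$ with $\|V'\|=\|U'\|\le k$ such that $p$ is an $\mathcal{E}$-winner of $(C,(V\setminus V')\cup U')$? *)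

theory Defs
  imports "HOL-Library.Multiset" "HOL-Computational_Algebra.Polynomial"
begin

subsection \<open>Deterministic multi-tape Turing machines\<close>

datatype 'a tape_symbol = Blank | Input 'a | Work nat

datatype direction = MoveLeft | Stay | MoveRight

text \<open>
  The states are \<open>0, \<dots>, states M - 1\<close> and \<open>0\<close> is initial. Besides the blank and the
  input letters, a machine may use the symbols \<open>Work 0, \<dots>, Work (works M - 1)\<close>.
  The transition function reads the scanned symbols of all tapes; \<open>None\<close> means halt.
\<close>

record 'a turing_machine =
  tapes :: nat
  states :: nat
  works :: nat
  delta :: "nat \<Rightarrow> 'a tape_symbol list \<Rightarrow> (nat \<times> ('a tape_symbol \<times> direction) list) option"

definition tape_alphabet :: "'a turing_machine \<Rightarrow> 'a tape_symbol set" where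
  "tape_alphabet M = {Blank} \<union> range Input \<union> Work ` {..<works M}"

text \<open>
  The type of input letters is finite, so the part of \<open>delta\<close> that is constrained here,
  and that is the only part a run can use, is a finite table.
\<close>

definition wf_tm :: "'a::finite turing_machine \<Rightarrow> bool" where
  "wf_tm M \<longleftrightarrow> tapes M \<ge> 1 \<and> states M \<ge> 1 \<and>
     (\<forall>q<states M. \<forall>ss. length ss = tapes M \<and> set ss \<subseteq> tape_alphabet M \<longrightarrow>
        (\<forall>q' as. delta M q ss = Some (q', as) \<longrightarrow>
           q' < states M \<and> length as = tapes M \<and> fst ` set as \<subseteq> tape_alphabet M))"

text \<open>Tapes are infinite in both directions; the second component is the head position.\<close>

type_synonym 'a tape = "(int \<Rightarrow> 'a tape_symbol) \<times> int"

type_synonym 'a config = "nat \<times> 'a tape list"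

definition tape_content :: "'a list \<Rightarrow> int \<Rightarrow> 'a tape_symbol" where
  "tape_content xs = (\<lambda>i. if 0 \<le> i \<and> i < int (length xs) then Input (xs ! nat i) else Blank)"

fun move :: "direction \<Rightarrow> int \<Rightarrow> int" where
  "move MoveLeft h = h - 1"
| "move Stay h = h"
| "move MoveRight h = h + 1"

fun scanned :: "'a tape \<Rightarrow> 'a tape_symbol" where
  "scanned (t, h) = t h"

fun act :: "'a tape \<Rightarrow> 'a tape_symbol \<times> direction \<Rightarrow> 'a tape" where
  "act (t, h) (s, d) = (t(h := s), move d h)"

fun step :: "'a turing_machine \<Rightarrow> 'a config \<Rightarrow> 'a config option" where
  "step M (q, ts) = (case delta M q (map scanned ts) of
      None \<Rightarrow> None
    | Some (q', as) \<Rightarrow> Some (q', map2 act ts as))"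

definition initial_config :: "'a turing_machine \<Rightarrow> 'a list \<Rightarrow> 'a config" where
  "initial_config M x =
     (0, (tape_content x, 0) # replicate (tapes M - 1) (\<lambda>_. Blank, 0))"

text \<open>The input is given on the first tape and the output is read off the last tape.\<close>

definition computes_within ::
  "'a turing_machine \<Rightarrow> 'a list \<Rightarrow> 'a list \<Rightarrow> nat \<Rightarrow> bool" where
  "computes_within M x y t \<longleftrightarrow>
     (\<exists>n\<le>t. \<exists>c. ((\<lambda>c c'. step M c = Some c') ^^ n) (initial_config M x) c \<and>
        step M c = None \<and> fst (last (snd c)) = tape_content y)"

definition poly_time_computable :: "('a::finite list \<Rightarrow> 'a list) \<Rightarrow> bool" where
  "poly_time_computable f \<longleftrightarrow>
     (\<exists>(M :: 'a turing_machine) (b :: nat poly).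
        wf_tm M \<and> (\<forall>x. computes_within M x (f x) (poly b (length x))))"

definition poly_many_one_reducible ::
  "'a::finite list set \<Rightarrow> 'a list set \<Rightarrow> bool"  (infix \<open>\<le>\<^sub>p\<close> 50) where
  "A \<le>\<^sub>p B \<longleftrightarrow> (\<exists>f. poly_time_computable f \<and> (\<forall>x. x \<in> A \<longleftrightarrow> f x \<in> B))"


subsection \<open>Elections and voting rules\<close>

text \<open>
  Candidates are named by natural numbers, so that they can be written down over a finite
  alphabet. A pair \<open>(a, b)\<close> in a vote means that \<open>a\<close> is preferred to \<open>b\<close>.
\<close>

type_synonym candidate = nat

type_synonym vote = "(candidate \<times> candidate) set"

definition is_vote :: "candidate set \<Rightarrow> vote \<Rightarrow> bool" where
  "is_vote C r \<longleftrightarrow> r \<subseteq> C \<times> C \<and> strict_linear_order_on C r"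

definition election :: "candidate set \<Rightarrow> vote multiset \<Rightarrow> bool" where
  "election C V \<longleftrightarrow> finite C \<and> (\<forall>r\<in>#V. is_vote C r)"

type_synonym voting_rule = "candidate set \<Rightarrow> vote multiset \<Rightarrow> candidate set"

definition is_voting_rule :: "voting_rule \<Rightarrow> bool" where
  "is_voting_rule E \<longleftrightarrow> (\<forall>C V. election C V \<longrightarrow> E C V \<subseteq> C)"


subsection \<open>The two problems\<close>

text \<open>
  In the bribery problem, \<open>V'\<close> are the old and \<open>W\<close> the new votes of the bribed voters.
\<close>

definition conformant_bribery ::
  "voting_rule \<Rightarrow> candidate set \<Rightarrow> vote multiset \<Rightarrow> nat \<Rightarrow> candidate \<Rightarrow> bool" where
  "conformant_bribery E C V k p \<longleftrightarrow>
     (\<exists>V' W. V' \<subseteq># V \<and> size V' \<le> k \<and> size W = size V' \<and> set_mset W \<subseteq> set_mset V \<and>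
        p \<in> E C (V - V' + W))"

definition control_by_replacing_voters ::
  "voting_rule \<Rightarrow> candidate set \<Rightarrow> vote multiset \<Rightarrow> vote multiset \<Rightarrow> nat \<Rightarrow> candidate \<Rightarrow> bool"
where
  "control_by_replacing_voters E C V U k p \<longleftrightarrow>
     (\<exists>V' U'. V' \<subseteq># V \<and> U' \<subseteq># U \<and> size V' = size U' \<and> size U' \<le> k \<and>
        p \<in> E C (V - V' + U'))"


subsection \<open>Encoding of instances\<close>

text \<open>A vote is written as the list of all candidates, most preferred candidate first.\<close>

definition order_of :: "candidate list \<Rightarrow> vote" where
  "order_of xs = {(xs ! i, xs ! j) | i j. i < j \<and> j < length xs}"

definition is_ranking :: "candidate set \<Rightarrow> candidate list \<Rightarrow> bool" where
  "is_ranking C xs \<longleftrightarrow> distinct xs \<and> set xs = C"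

text \<open>The multiset of voters is listed explicitly, voter by voter, in any order.\<close>

definition lists_votes :: "candidate set \<Rightarrow> candidate list list \<Rightarrow> vote multiset \<Rightarrow> bool" where
  "lists_votes C Rs V \<longleftrightarrow> (\<forall>xs\<in>set Rs. is_ranking C xs) \<and> V = mset (map order_of Rs)"

datatype letter = Zero | One | Comma | Semicolon | Hash

instance letter :: finite
proof
  have "(UNIV :: letter set) \<subseteq> {Zero, One, Comma, Semicolon, Hash}"
    using letter.exhaust by blast
  then show "finite (UNIV :: letter set)"
    by (rule finite_subset) simp
qed

text \<open>Binary notation, least significant bit first, without leading zeros.\<close>

fun bits :: "nat \<Rightarrow> letter list" where
  "bits n = (if n = 0 then [] else (if odd n then One else Zero) # bits (n div 2))"

declare bits.simps [simp del]

definition encode_candidates :: "candidate list \<Rightarrow> letter list" where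
  "encode_candidates xs = concat (map (\<lambda>c. bits c @ [Comma]) xs)"

definition encode_votes :: "candidate list list \<Rightarrow> letter list" where
  "encode_votes Rs = concat (map (\<lambda>xs. encode_candidates xs @ [Semicolon]) Rs)"

definition encode_fields :: "letter list list \<Rightarrow> letter list" where
  "encode_fields fs = concat (map (\<lambda>w. w @ [Hash]) fs)"

definition conformant_bribery_language :: "voting_rule \<Rightarrow> letter list set" where
  "conformant_bribery_language E =
     {encode_fields [encode_candidates Cs, encode_votes Rs, bits k, bits p] | Cs C Rs V k p.
        is_ranking C Cs \<and> lists_votes C Rs V \<and> election C V \<and> p \<in> C \<and>
        conformant_bribery E C V k p}"

definition replacing_voters_language :: "voting_rule \<Rightarrow> letter list set" where
  "replacing_voters_language E =
     {encode_fields
        [encode_candidates Cs, encode_votes Rs, encode_votes Ss, bits k, bits p] |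
        Cs C Rs V Ss U k p.
        is_ranking C Cs \<and> lists_votes C Rs V \<and> election C V \<and>
        lists_votes C Ss U \<and> election C U \<and> p \<in> C \<and>
        control_by_replacing_voters E C V U k p}"

text \<open>Rankings of a finite set are exactly the representations of its strict total orders.\<close>

lemma is_vote_order_of:
  assumes "is_ranking C xs"
  shows "is_vote C (order_of xs)"
proof -
  have d: "distinct xs" and s: "set xs = C"
    using assms by (auto simp: is_ranking_def)
  have "trans (order_of xs)"
  proof (rule transI)
    fix a b c assume "(a, b) \<in> order_of xs" "(b, c) \<in> order_of xs"
    then obtain i j j' l where "a = xs ! i" "b = xs ! j" "i < j" "j < length xs"
        "b = xs ! j'" "c = xs ! l" "j' < l" "l < length xs"
      unfolding order_of_def by auto
    moreover from this d have "j = j'"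
      by (simp add: nth_eq_iff_index_eq)
    ultimately show "(a, c) \<in> order_of xs"
      unfolding order_of_def using less_trans by blast
  qed
  moreover have "irrefl (order_of xs)"
    using d by (auto simp: irrefl_def order_of_def nth_eq_iff_index_eq)
  moreover have "total_on C (order_of xs)"
  proof (rule total_onI)
    fix a b assume "a \<in> C" "b \<in> C" "a \<noteq> b"
    with s obtain i j where "a = xs ! i" "b = xs ! j" "i < length xs" "j < length xs" "i \<noteq> j"
      by (metis in_set_conv_nth)
    then show "(a, b) \<in> order_of xs \<or> (b, a) \<in> order_of xs"
      unfolding order_of_def by (cases i j rule: linorder_cases) blast+
  qed
  moreover have "order_of xs \<subseteq> C \<times> C"
    using s by (auto simp: order_of_def)
  ultimately show ?thesis
    by (simp add: is_vote_def strict_linear_order_on_def)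
qed

lemma order_of_Cons: "order_of (x # xs) = {x} \<times> set xs \<union> order_of xs"
proof (intro set_eqI iffI)
  fix e assume "e \<in> order_of (x # xs)"
  then obtain i j where e: "e = ((x # xs) ! i, (x # xs) ! j)" "i < j" "j < length (x # xs)"
    unfolding order_of_def by auto
  then obtain j' where "j = Suc j'" by (cases j) auto
  with e show "e \<in> {x} \<times> set xs \<union> order_of xs"
    by (cases i) (auto simp: order_of_def)
next
  fix e assume "e \<in> {x} \<times> set xs \<union> order_of xs"
  then show "e \<in> order_of (x # xs)"
  proof
    assume "e \<in> {x} \<times> set xs"
    then obtain j where "e = ((x # xs) ! 0, (x # xs) ! Suc j)" "j < length xs"
      by (auto simp: in_set_conv_nth)
    then show ?thesis
      unfolding order_of_def by fastforce
  next
    assume "e \<in> order_of xs"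
    then obtain i j where "e = ((x # xs) ! Suc i, (x # xs) ! Suc j)" "i < j" "j < length xs"
      unfolding order_of_def by auto
    then show ?thesis
      unfolding order_of_def by fastforce
  qed
qed

lemma ex_ranking:
  assumes "finite C" "is_vote C r"
  shows "\<exists>xs. is_ranking C xs \<and> order_of xs = r"
  using assms
proof (induction "card C" arbitrary: C r)
  case 0
  then have "C = {}" "r = {}" by (auto simp: is_vote_def)
  then show ?case
    by (intro exI[of _ "[]"]) (auto simp: is_ranking_def order_of_def)
next
  case (Suc n)
  have sub: "r \<subseteq> C \<times> C" and tr: "trans r" and ir: "irrefl r" and tot: "total_on C r"
    using Suc.prems by (auto simp: is_vote_def strict_linear_order_on_def)
  have "finite r" using sub Suc.prems(1) by (meson finite_SigmaI finite_subset)
  moreover have "acyclic r" using tr ir by (simp add: acyclic_irrefl)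
  ultimately have "wf r" by (rule finite_acyclic_wf)
  moreover obtain c where "c \<in> C" using Suc.hyps(2) by fastforce
  ultimately obtain x where x: "x \<in> C" "\<And>y. (y, x) \<in> r \<Longrightarrow> y \<notin> C"
    by (metis wfE_min)
  let ?D = "C - {x}" and ?s = "r \<inter> (C - {x}) \<times> (C - {x})"
  have "is_vote ?D ?s"
    using tr ir tot
    by (auto simp: is_vote_def strict_linear_order_on_def trans_def irrefl_def total_on_def)
  moreover have "n = card ?D" "finite ?D" using Suc x by auto
  ultimately obtain xs where xs: "is_ranking ?D xs" "order_of xs = ?s"
    using Suc.hyps(1) by blast
  have "r = {x} \<times> ?D \<union> ?s"
    using sub x tot ir by (auto simp: total_on_def irrefl_def)
  with xs x(1) have "is_ranking C (x # xs) \<and> order_of (x # xs) = r"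
    by (auto simp: is_ranking_def order_of_Cons)
  then show ?case by blast
qed

end

theory Submission
  imports Defs
begin

text \<open>
  A bribed voter may copy any vote of \<open>V\<close>, arbitrarily often, but at most \<open>size V\<close> copies are
  ever needed; so \<open>m\<close> copies of \<open>V\<close>, for any \<open>m \<ge> size V\<close>, serve as the unregistered voters,
  and the limit need not change. The machine takes for \<open>m\<close> the length \<open>|v|\<close> of the field \<open>v\<close>
  that encodes the votes, mapping \<open>u#v#w\<close> to \<open>u#v#v\<^sup>m#w\<close>. Malformed inputs need no test:
  if the output is a valid encoding then so is the input, and words with fewer than two
  separators, which lie in neither language, are copied unchanged.
\<close>

subsection \<open>Bribery as replacement\<close>

text \<open>Both directions keep the removed votes and the inserted votes. All that changes is
  whether the inserted votes are bounded by their support or by the multiplicities available in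
  \<open>repeat_mset m V\<close>.\<close>

lemma conformant_bribery_iff_replacing_copies:
  assumes "size V \<le> m"
  shows "conformant_bribery E C V k p \<longleftrightarrow>
    control_by_replacing_voters E C V (repeat_mset m V) k p"
proof
  assume "conformant_bribery E C V k p"
  then obtain V' W where *: "V' \<subseteq># V" "size V' \<le> k" "size W = size V'"
      "set_mset W \<subseteq> set_mset V" "p \<in> E C (V - V' + W)"
    unfolding conformant_bribery_def by blast
  have "count W r \<le> count (repeat_mset m V) r" for r
  proof (cases "r \<in># W")
    case True
    with *(4) have "1 \<le> count V r" by auto
    \<comment> \<open>Even if all of \<open>W\<close> consisted of copies of \<open>r\<close>, one
      occurrence of \<open>r\<close> in \<open>V\<close> already yields \<open>m\<close> occurrences
      among the copies.\<close>
    have "count W r \<le> size W" by (rule count_le_size)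
    also have "\<dots> \<le> m" using *(1,3) assms size_mset_mono[of V' V] by linarith
    also have "\<dots> \<le> m * count V r" using \<open>1 \<le> count V r\<close> by simp
    finally show ?thesis by simp
  qed (simp add: not_in_iff)
  then have "W \<subseteq># repeat_mset m V" by (simp add: subseteq_mset_def)
  with * show "control_by_replacing_voters E C V (repeat_mset m V) k p"
    unfolding control_by_replacing_voters_def by (intro exI[of _ V'] exI[of _ W]) auto
next
  assume "control_by_replacing_voters E C V (repeat_mset m V) k p"
  then obtain V' U' where *: "V' \<subseteq># V" "U' \<subseteq># repeat_mset m V" "size V' = size U'"
      "size U' \<le> k" "p \<in> E C (V - V' + U')"
    unfolding control_by_replacing_voters_def by blast
  have "set_mset U' \<subseteq> set_mset V"
    using set_mset_mono[OF *(2)] by (auto simp: count_greater_zero_iff[symmetric]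
      simp del: count_greater_zero_iff)
  with * show "conformant_bribery E C V k p"
    unfolding conformant_bribery_def by (intro exI[of _ V'] exI[of _ U']) auto
qed

subsection \<open>Unique readability of the encodings\<close>

text \<open>The first occurrence of \<open>s\<close> marks where the prefix ends, so the split is
  determined by the word.\<close>

lemma append_separator_eq_iff:
  assumes "s \<notin> set xs" "s \<notin> set xs'"
  shows "xs @ s # ys = xs' @ s # ys' \<longleftrightarrow> xs = xs' \<and> ys = ys'"
  using assms
proof (induction xs arbitrary: xs')
  case Nil then show ?case by (cases xs') auto
next
  case (Cons x xs) then show ?case by (cases xs') auto
qed

text \<open>Blocks are read off one at a time, each up to the first \<open>s\<close>. Since
  \<open>s\<close> terminates blocks rather than separating them, the empty list differs from the
  list of one empty block. Applied with \<open>Comma\<close> and then with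
  \<open>Semicolon\<close>.\<close>

lemma inj_concat_terminated:
  assumes "inj f" "\<And>w. s \<notin> set (f w)"
  shows "inj (\<lambda>ws. concat (map (\<lambda>w. f w @ [s]) ws))"
proof (rule injI)
  fix ws ws'
  assume "concat (map (\<lambda>w. f w @ [s]) ws) = concat (map (\<lambda>w. f w @ [s]) ws')"
  then show "ws = ws'"
  proof (induction ws arbitrary: ws')
    case Nil then show ?case by (cases ws') auto
  next
    case (Cons w ws)
    then obtain w' vs where "ws' = w' # vs" by (cases ws') auto
    with Cons assms show ?case
      by (auto simp: append_separator_eq_iff inj_eq)
  qed
qed

lemma set_bits: "set (bits n) \<subseteq> {Zero, One}"
  by (induction n rule: bits.induct) (subst bits.simps, auto)

text \<open>The first letter gives the parity and the tail encodes the half; only 0 has the empty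
  word.\<close>

lemma inj_bits: "inj bits"
proof (rule injI)
  fix m n show "bits m = bits n \<Longrightarrow> m = n"
  proof (induction m arbitrary: n rule: bits.induct)
    case (1 m)
    show ?case
    proof (cases "m = 0 \<or> n = 0")
      case True
      with "1.prems" show ?thesis
        by (subst (asm) (1 2) bits.simps) (auto split: if_splits)
    next
      case False
      with "1.prems" have e: "odd m = odd n" "bits (m div 2) = bits (n div 2)"
        by (subst (asm) (1 2) bits.simps, auto split: if_splits)+
      with "1.IH" False have "m div 2 = n div 2" by blast
      with e(1) show ?thesis by (metis bit_eq_rec)
    qed
  qed
qed

lemma set_encode_candidates: "set (encode_candidates xs) \<subseteq> {Zero, One, Comma}"
  unfolding encode_candidates_def using set_bits by (induction xs) auto

lemma set_encode_votes: "set (encode_votes Rs) \<subseteq> {Zero, One, Comma, Semicolon}"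
  unfolding encode_votes_def using set_encode_candidates by (induction Rs) fastforce+

lemma Hash_notin_encodings:
  "Hash \<notin> set (bits n)" "Hash \<notin> set (encode_candidates xs)" "Hash \<notin> set (encode_votes Rs)"
  using set_bits[of n] set_encode_candidates[of xs] set_encode_votes[of Rs] by auto

lemma inj_encode_candidates: "inj encode_candidates"
proof -
  have "Comma \<notin> set (bits n)" for n using set_bits[of n] by auto
  then show ?thesis
    unfolding encode_candidates_def by (intro inj_concat_terminated inj_bits)
qed

lemma inj_encode_votes: "inj encode_votes"
proof -
  have "Semicolon \<notin> set (encode_candidates xs)" for xs
    using set_encode_candidates[of xs] by auto
  then show ?thesis
    unfolding encode_votes_def by (intro inj_concat_terminated inj_encode_candidates)
qed

section \<open>Copies of a list of votes\<close>

text \<open>This lets a machine duplicate the voters by repeating a word, without parsing any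
  vote.\<close>

lemma encode_votes_copies:
  "encode_votes (concat (replicate m Rs)) = concat (replicate m (encode_votes Rs))"
  by (induction m) (auto simp: encode_votes_def)

text \<open>Each vote contributes at least its \<open>Semicolon\<close>. Hence the length of the
  field is an admissible number of copies.\<close>

lemma length_le_encode_votes: "length Rs \<le> length (encode_votes Rs)"
  by (induction Rs) (auto simp: encode_votes_def)

lemma lists_votes_copies:
  assumes "lists_votes C Rs V"
  shows "lists_votes C (concat (replicate m Rs)) (repeat_mset m V)"
proof -
  have "mset (map order_of (concat (replicate m Rs))) = repeat_mset m (mset (map order_of Rs))"
    by (induction m) auto
  with assms show ?thesis by (auto simp: lists_votes_def)
qed

lemma election_copies: "election C V \<Longrightarrow> election C (repeat_mset m V)"
  by (auto simp: election_def count_greater_zero_iff[symmetric] simp del: count_greater_zero_iff)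

subsection \<open>Correctness of the reduction\<close>

text \<open>Together with its analogue for the other language, this is used in contrapositive form
  for the inputs that are copied unchanged.\<close>

lemma conformant_bribery_language_separators:
  assumes "x \<in> conformant_bribery_language E"
  obtains u v w where "x = u @ Hash # v @ Hash # w" "Hash \<notin> set u" "Hash \<notin> set v"
  using assms
  by (fastforce simp: conformant_bribery_language_def encode_fields_def Hash_notin_encodings)

lemma replacing_voters_language_separators:
  assumes "x \<in> replacing_voters_language E"
  obtains u v w where "x = u @ Hash # v @ Hash # w" "Hash \<notin> set u" "Hash \<notin> set v"
  using assms
  by (fastforce simp: replacing_voters_language_def encode_fields_def Hash_notin_encodings)

text \<open>The word \<open>w\<close> is arbitrary: from right to left, unique readability shows
  that \<open>u\<close>, \<open>v\<close> and \<open>w\<close> have the required form.\<close>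

lemma language_iff_copies:
  assumes u: "Hash \<notin> set u" and v: "Hash \<notin> set v"
  shows "u @ Hash # v @ Hash # w \<in> conformant_bribery_language E \<longleftrightarrow>
    u @ Hash # v @ Hash # concat (replicate (length v) v) @ Hash # w
      \<in> replacing_voters_language E" (is "?x \<in> _ \<longleftrightarrow> ?y \<in> _")
proof
  assume "?x \<in> conformant_bribery_language E"
  then obtain Cs C Rs V k p where
    x: "?x = encode_fields [encode_candidates Cs, encode_votes Rs, bits k, bits p]"
    and *: "is_ranking C Cs" "lists_votes C Rs V" "election C V" "p \<in> C"
      "conformant_bribery E C V k p"
    unfolding conformant_bribery_language_def by blast
  from x have uvw: "u = encode_candidates Cs" "v = encode_votes Rs"
      "w = bits k @ Hash # bits p @ [Hash]"
    using u v by (auto simp: encode_fields_def append_separator_eq_iff Hash_notin_encodings)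
  let ?m = "length v"
  have "size V \<le> ?m"
    using *(2) length_le_encode_votes[of Rs] uvw(2) by (auto simp: lists_votes_def)
  with *(5) have "control_by_replacing_voters E C V (repeat_mset ?m V) k p"
    by (simp add: conformant_bribery_iff_replacing_copies)
  moreover have "?y = encode_fields [encode_candidates Cs, encode_votes Rs,
      encode_votes (concat (replicate ?m Rs)), bits k, bits p]"
    unfolding encode_votes_copies by (simp add: encode_fields_def uvw)
  ultimately show "?y \<in> replacing_voters_language E"
    using * lists_votes_copies election_copies unfolding replacing_voters_language_def by blast
next
  let ?m = "length v"
  assume "?y \<in> replacing_voters_language E"
  then obtain Cs C Rs V Ss U k p where
    y: "?y = encode_fields
      [encode_candidates Cs, encode_votes Rs, encode_votes Ss, bits k, bits p]"
    and *: "is_ranking C Cs" "lists_votes C Rs V" "election C V" "lists_votes C Ss U"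
      "p \<in> C" "control_by_replacing_voters E C V U k p"
    unfolding replacing_voters_language_def by blast
  \<comment> \<open>The repeated word is thus a single field, and the two sides of \<open>y\<close>
    can be matched field by field.\<close>
  have "Hash \<notin> set (concat (replicate ?m v))" using v by auto
  with y have uvw: "u = encode_candidates Cs" "v = encode_votes Rs"
      "concat (replicate ?m v) = encode_votes Ss" "w = bits k @ Hash # bits p @ [Hash]"
    using u v by (auto simp: encode_fields_def append_separator_eq_iff Hash_notin_encodings)
  \<comment> \<open>The encoding of the copied list is the same word as the encoding of
    \<open>Ss\<close>, so injectivity identifies the lists.\<close>
  then have "Ss = concat (replicate ?m Rs)"
    using inj_encode_votes by (metis encode_votes_copies injD)
  with *(4) lists_votes_copies[OF *(2), of ?m] have "U = repeat_mset ?m V"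
    by (simp add: lists_votes_def)
  moreover have "size V \<le> ?m"
    using *(2) length_le_encode_votes[of Rs] uvw(2) by (auto simp: lists_votes_def)
  ultimately have "conformant_bribery E C V k p"
    using *(6) by (simp add: conformant_bribery_iff_replacing_copies)
  moreover have "?x = encode_fields [encode_candidates Cs, encode_votes Rs, bits k, bits p]"
    by (simp add: encode_fields_def uvw)
  ultimately show "?x \<in> conformant_bribery_language E"
    using * unfolding conformant_bribery_language_def by blast
qed

subsection \<open>A machine for the reduction\<close>

text \<open>
  States 0 and 1 copy \<open>u#\<close> and \<open>v#\<close> to the output, state 1 also saves \<open>v\<close> on the second
  tape. The input head then walks back over \<open>v\<close>, as a counter: for each letter state 2 rewinds
  the second tape and state 3 appends its content to the output. At the first separator,
  state 4 skips \<open>v\<close> again and state 5 copies the rest.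
\<close>

fun dup_delta :: "nat \<Rightarrow> letter tape_symbol list \<Rightarrow>
    (nat \<times> (letter tape_symbol \<times> direction) list) option" where
  "dup_delta q [a, b, c] =
    (if q = 0 then
       if a = Blank then None
       else Some (if a = Input Hash then 1 else 0, [(a, MoveRight), (b, Stay), (a, MoveRight)])
     else if q = 1 then
       if a = Blank then None
       else if a = Input Hash then Some (2, [(a, MoveLeft), (b, MoveLeft), (a, MoveRight)])
       else Some (1, [(a, MoveRight), (a, MoveRight), (a, MoveRight)])
     else if q = 2 then
       if b \<noteq> Blank then Some (2, [(a, Stay), (b, MoveLeft), (c, Stay)])
       else if a = Input Hash then Some (4, [(a, MoveRight), (b, Stay), (c, Stay)])
       else Some (3, [(a, MoveLeft), (b, MoveRight), (c, Stay)])
     else if q = 3 then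
       if b \<noteq> Blank then Some (3, [(a, Stay), (b, MoveRight), (b, MoveRight)])
       else Some (2, [(a, Stay), (b, MoveLeft), (c, Stay)])
     else if q = 4 then
       if a = Input Hash then Some (5, [(a, MoveRight), (b, Stay), (a, MoveRight)])
       else Some (4, [(a, MoveRight), (b, Stay), (c, Stay)])
     else
       if a = Blank then None
       else Some (5, [(a, MoveRight), (b, Stay), (a, MoveRight)]))"
| "dup_delta q _ = None"

definition dup_tm :: "letter turing_machine" where
  "dup_tm = \<lparr>tapes = 3, states = 6, works = 0, delta = dup_delta\<rparr>"

text \<open>Every symbol written is one of the scanned symbols, so the tape alphabet is never
  left.\<close>

lemma wf_dup_tm: "wf_tm dup_tm"
proof -
  have "q' < 6 \<and> length as = 3 \<and> fst ` set as \<subseteq> tape_alphabet dup_tm"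
    if l: "length ss = 3" and ss: "set ss \<subseteq> tape_alphabet dup_tm"
      and d: "dup_delta q ss = Some (q', as)" for q ss q' as
  proof -
    from l obtain a b c where "ss = [a, b, c]"
      by (auto simp: numeral_3_eq_3 length_Suc_conv)
    with d ss show ?thesis by (auto split: if_splits)
  qed
  moreover have "tapes dup_tm = 3" "states dup_tm = 6" "delta dup_tm = dup_delta"
    by (simp_all add: dup_tm_def)
  ultimately show ?thesis by (simp add: wf_tm_def) blast
qed

section \<open>Configurations and timed runs\<close>

text \<open>The input tape is always written back unchanged, and the output head always stands on
  the first blank after \<open>out\<close>, so its position needs no parameter.\<close>

definition dup_config ::
  "letter list \<Rightarrow> nat \<Rightarrow> int \<Rightarrow> letter list \<Rightarrow> int \<Rightarrow> letter list \<Rightarrow> letter config" where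
  "dup_config x q i z j out =
     (q, [(tape_content x, i), (tape_content z, j), (tape_content out, int (length out))])"

definition runs :: "nat \<Rightarrow> letter config \<Rightarrow> letter config \<Rightarrow> bool" where
  "runs n = (\<lambda>c c'. step dup_tm c = Some c') ^^ n"

lemma runs_trans: "runs m a b \<Longrightarrow> runs n b c \<Longrightarrow> runs (m + n) a c"
  by (auto simp: runs_def relpowp_add)

lemma runs_0 [simp]: "runs 0 a a"
  by (simp add: runs_def)

lemma runs_1: "step dup_tm a = Some b \<Longrightarrow> runs 1 a b"
  unfolding runs_def by (simp only: relpowp_1)

lemma runs_Suc: "step dup_tm a = Some b \<Longrightarrow> runs n b c \<Longrightarrow> runs (Suc n) a c"
  using runs_trans[OF runs_1] by fastforce

lemma tape_content_nth: "tape_content (a @ s # b) (int (length a)) = Input s"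
  by (simp add: tape_content_def nth_append)

lemma tape_content_Blank: "i < 0 \<or> int (length x) \<le> i \<Longrightarrow> tape_content x i = Blank"
  by (auto simp: tape_content_def)

lemma tape_content_snoc:
  "(tape_content out)(int (length out) := Input s) = tape_content (out @ [s])"
  by (rule ext) (auto simp: tape_content_def nth_append)

lemmas dup_step_simps =
  dup_config_def dup_tm_def tape_content_nth tape_content_Blank tape_content_snoc

section \<open>Runs that stay in one state\<close>

text \<open>The prefix \<open>a\<close> already read and the output vary in the induction, as each
  step shifts one letter from \<open>u\<close> to both.\<close>

lemma runs_copy_state0:
  assumes "x = a @ u @ b" "Hash \<notin> set u"
  shows "runs (length u) (dup_config x 0 (int (length a)) z j out)
    (dup_config x 0 (int (length (a @ u))) z j (out @ u))"
  using assms
proof (induction u arbitrary: a out)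
  case (Cons s u)
  have "step dup_tm (dup_config x 0 (int (length a)) z j out) =
      Some (dup_config x 0 (int (length (a @ [s]))) z j (out @ [s]))"
    using Cons.prems by (auto simp: dup_step_simps)
  moreover have "runs (length u) (dup_config x 0 (int (length (a @ [s]))) z j (out @ [s]))
      (dup_config x 0 (int (length ((a @ [s]) @ u))) z j ((out @ [s]) @ u))"
    using Cons.prems by (intro Cons.IH) auto
  ultimately show ?case using runs_Suc by fastforce
qed simp

lemma runs_copy_state1:
  assumes "x = a @ u @ b" "Hash \<notin> set u"
  shows "runs (length u) (dup_config x 1 (int (length a)) z (int (length z)) out)
    (dup_config x 1 (int (length (a @ u))) (z @ u) (int (length (z @ u))) (out @ u))"
  using assms
proof (induction u arbitrary: a z out)
  case (Cons s u)
  have "step dup_tm (dup_config x 1 (int (length a)) z (int (length z)) out) =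
      Some (dup_config x 1 (int (length (a @ [s]))) (z @ [s]) (int (length (z @ [s])))
        (out @ [s]))"
    using Cons.prems by (auto simp: dup_step_simps)
  moreover have "runs (length u)
      (dup_config x 1 (int (length (a @ [s]))) (z @ [s]) (int (length (z @ [s]))) (out @ [s]))
      (dup_config x 1 (int (length ((a @ [s]) @ u))) ((z @ [s]) @ u)
        (int (length ((z @ [s]) @ u))) ((out @ [s]) @ u))"
    using Cons.prems by (intro Cons.IH) auto
  ultimately show ?case using runs_Suc by fastforce
qed simp

text \<open>The head starts on the last letter of \<open>a\<close> and moves left, hence the
  induction from the right. It stops on the blank cell -1, the left end marker.\<close>

lemma runs_rewind_state2:
  assumes "z = a @ b"
  shows "runs (length a) (dup_config x 2 i z (int (length a) - 1) out)
    (dup_config x 2 i z (- 1) out)"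
  using assms
proof (induction a arbitrary: b rule: rev_induct)
  case (snoc s a)
  have "step dup_tm (dup_config x 2 i z (int (length (a @ [s])) - 1) out) =
      Some (dup_config x 2 i z (int (length a) - 1) out)"
    using snoc.prems by (auto simp: dup_step_simps)
  moreover have "runs (length a) (dup_config x 2 i z (int (length a) - 1) out)
      (dup_config x 2 i z (- 1) out)"
    using snoc.prems by (intro snoc.IH[of "[s] @ b"]) auto
  ultimately show ?case using runs_Suc by fastforce
qed simp

lemma runs_copy_state3:
  assumes "z = a @ b"
  shows "runs (length b) (dup_config x 3 i z (int (length a)) out)
    (dup_config x 3 i z (int (length z)) (out @ b))"
  using assms
proof (induction b arbitrary: a out)
  case (Cons s b)
  have "step dup_tm (dup_config x 3 i z (int (length a)) out) =
      Some (dup_config x 3 i z (int (length (a @ [s]))) (out @ [s]))"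
    using Cons.prems by (auto simp: dup_step_simps)
  moreover have "runs (length b) (dup_config x 3 i z (int (length (a @ [s]))) (out @ [s]))
      (dup_config x 3 i z (int (length z)) ((out @ [s]) @ b))"
    using Cons.prems by (intro Cons.IH) auto
  ultimately show ?case using runs_Suc by fastforce
qed simp

lemma runs_skip_state4:
  assumes "x = a @ u @ b" "Hash \<notin> set u"
  shows "runs (length u) (dup_config x 4 (int (length a)) z j out)
    (dup_config x 4 (int (length (a @ u))) z j out)"
  using assms
proof (induction u arbitrary: a)
  case (Cons s u)
  have "step dup_tm (dup_config x 4 (int (length a)) z j out) =
      Some (dup_config x 4 (int (length (a @ [s]))) z j out)"
    using Cons.prems by (auto simp: dup_step_simps)
  moreover have "runs (length u) (dup_config x 4 (int (length (a @ [s]))) z j out)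
      (dup_config x 4 (int (length ((a @ [s]) @ u))) z j out)"
    using Cons.prems by (intro Cons.IH) auto
  ultimately show ?case using runs_Suc by fastforce
qed simp

lemma runs_copy_state5:
  assumes "x = a @ u"
  shows "runs (length u) (dup_config x 5 (int (length a)) z j out)
    (dup_config x 5 (int (length x)) z j (out @ u))"
  using assms
proof (induction u arbitrary: a out)
  case (Cons s u)
  have "step dup_tm (dup_config x 5 (int (length a)) z j out) =
      Some (dup_config x 5 (int (length (a @ [s]))) z j (out @ [s]))"
    using Cons.prems by (auto simp: dup_step_simps)
  moreover have "runs (length u) (dup_config x 5 (int (length (a @ [s]))) z j (out @ [s]))
      (dup_config x 5 (int (length x)) z j ((out @ [s]) @ u))"
    using Cons.prems by (intro Cons.IH) auto
  ultimately show ?case using runs_Suc by fastforce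
qed simp

section \<open>The loop that counts with the letters of \<open>v\<close>\<close>

text \<open>One round: rewind \<open>z\<close>, turn at its left blank while the input head moves
  left, copy \<open>z\<close>, turn at its right blank.\<close>

lemma runs_append_copy:
  assumes "x = a @ s # b" "s \<noteq> Hash"
  shows "runs (2 * length z + 2) (dup_config x 2 (int (length a)) z (int (length z) - 1) out)
    (dup_config x 2 (int (length a) - 1) z (int (length z) - 1) (out @ z))"
proof -
  have "runs (length z) (dup_config x 2 (int (length a)) z (int (length z) - 1) out)
      (dup_config x 2 (int (length a)) z (- 1) out)"
    by (rule runs_rewind_state2[of z z "[]"]) simp
  moreover have "runs 1 (dup_config x 2 (int (length a)) z (- 1) out)
      (dup_config x 3 (int (length a) - 1) z 0 out)"
    using assms by (intro runs_1) (auto simp: dup_step_simps)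
  moreover have "runs (length z) (dup_config x 3 (int (length a) - 1) z 0 out)
      (dup_config x 3 (int (length a) - 1) z (int (length z)) (out @ z))"
    using runs_copy_state3[of z "[]" z] by simp
  moreover have "runs 1 (dup_config x 3 (int (length a) - 1) z (int (length z)) (out @ z))
      (dup_config x 2 (int (length a) - 1) z (int (length z) - 1) (out @ z))"
    by (intro runs_1) (auto simp: dup_step_simps)
  ultimately have "runs (length z + 1 + length z + 1)
      (dup_config x 2 (int (length a)) z (int (length z) - 1) out)
      (dup_config x 2 (int (length a) - 1) z (int (length z) - 1) (out @ z))"
    by (blast intro: runs_trans)
  moreover have "length z + 1 + length z + 1 = 2 * length z + 2" by simp
  ultimately show ?thesis by argo
qed

text \<open>Here \<open>u\<close> is the counter, consumed from right to left, and \<open>z\<close>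
  the word copied; both will be \<open>v\<close>.\<close>

lemma runs_append_copies:
  assumes "x = a @ u @ b" "Hash \<notin> set u"
  shows "runs (length u * (2 * length z + 2))
    (dup_config x 2 (int (length (a @ u)) - 1) z (int (length z) - 1) out)
    (dup_config x 2 (int (length a) - 1) z (int (length z) - 1)
      (out @ concat (replicate (length u) z)))"
  using assms
proof (induction u arbitrary: b out rule: rev_induct)
  case (snoc s u)
  have "runs (2 * length z + 2)
      (dup_config x 2 (int (length (a @ u @ [s])) - 1) z (int (length z) - 1) out)
      (dup_config x 2 (int (length (a @ u)) - 1) z (int (length z) - 1) (out @ z))"
    using runs_append_copy[of x "a @ u" s b z out] snoc.prems by force
  moreover have "runs (length u * (2 * length z + 2))
      (dup_config x 2 (int (length (a @ u)) - 1) z (int (length z) - 1) (out @ z))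
      (dup_config x 2 (int (length a) - 1) z (int (length z) - 1)
        ((out @ z) @ concat (replicate (length u) z)))"
    using snoc.prems by (intro snoc.IH[of "s # b"]) auto
  ultimately have "runs (2 * length z + 2 + length u * (2 * length z + 2))
      (dup_config x 2 (int (length (a @ u @ [s])) - 1) z (int (length z) - 1) out)
      (dup_config x 2 (int (length a) - 1) z (int (length z) - 1)
        ((out @ z) @ concat (replicate (length u) z)))"
    by (rule runs_trans)
  then show ?case by (simp add: add_ac)
qed simp

section \<open>Complete runs, by the number of separators\<close>

lemma initial_config_dup_tm: "initial_config dup_tm x = dup_config x 0 0 [] 0 []"
  by (simp add: initial_config_def dup_tm_def dup_config_def tape_content_def fun_eq_iff
    numeral_2_eq_2)

lemma computes_withinI:
  assumes "runs n (dup_config x 0 0 [] 0 []) (dup_config x q i z j y)" "n \<le> t"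
    "step dup_tm (dup_config x q i z j y) = None"
  shows "computes_within dup_tm x y t"
  unfolding computes_within_def initial_config_dup_tm
  using assms unfolding runs_def by (intro exI[of _ n] conjI exI[of _ "dup_config x q i z j y"])
    (auto simp: dup_config_def)

lemma runs_first_separator:
  assumes "x = u @ Hash # v" "Hash \<notin> set u"
  shows "runs (length u + 1) (dup_config x 0 0 [] 0 [])
    (dup_config x 1 (int (length (u @ [Hash]))) [] 0 (u @ [Hash]))"
proof -
  have "runs (length u) (dup_config x 0 0 [] 0 []) (dup_config x 0 (int (length u)) [] 0 u)"
    using runs_copy_state0[of x "[]" u "Hash # v" "[]" 0 "[]"] assms by simp
  moreover have "runs 1 (dup_config x 0 (int (length u)) [] 0 u)
      (dup_config x 1 (int (length (u @ [Hash]))) [] 0 (u @ [Hash]))"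
    using assms by (intro runs_1) (auto simp: dup_step_simps)
  ultimately show ?thesis by (rule runs_trans)
qed

lemma computes_no_separator:
  assumes "Hash \<notin> set x"
  shows "computes_within dup_tm x x (length x)"
proof (rule computes_withinI[OF _ order_refl])
  show "runs (length x) (dup_config x 0 0 [] 0 []) (dup_config x 0 (int (length x)) [] 0 x)"
    using runs_copy_state0[of x "[]" x "[]" "[]" 0 "[]"] assms by simp
qed (simp add: dup_step_simps)

lemma computes_one_separator:
  assumes "x = u @ Hash # v" "Hash \<notin> set u" "Hash \<notin> set v"
  shows "computes_within dup_tm x x (length x)"
proof (rule computes_withinI)
  have "runs (length v) (dup_config x 1 (int (length (u @ [Hash]))) [] 0 (u @ [Hash]))
      (dup_config x 1 (int (length x)) v (int (length v)) x)"
    using runs_copy_state1[of x "u @ [Hash]" v "[]" "[]" "u @ [Hash]"] assms by simp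
  with runs_first_separator[OF assms(1,2)]
  show "runs (length u + 1 + length v) (dup_config x 0 0 [] 0 [])
      (dup_config x 1 (int (length x)) v (int (length v)) x)"
    by (rule runs_trans)
qed (use assms in \<open>simp_all add: dup_step_simps\<close>)

lemma computes_copies:
  assumes x: "x = u @ Hash # v @ Hash # w" and u: "Hash \<notin> set u" and v: "Hash \<notin> set v"
  shows "computes_within dup_tm x (u @ Hash # v @ Hash # concat (replicate (length v) v) @ Hash # w)
    (5 + 5 * length x + 2 * (length x)\<^sup>2)"
proof -
  let ?a = "u @ [Hash]" and ?o = "u @ Hash # v @ [Hash]"
  let ?c = "?o @ concat (replicate (length v) v)"
  let ?l = "int (length v)"
  have "runs (length v) (dup_config x 1 (int (length ?a)) [] 0 ?a)
      (dup_config x 1 (int (length (?a @ v))) v ?l (?a @ v))"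
    using runs_copy_state1[of x ?a v "Hash # w" "[]" ?a] assms by simp
  \<comment> \<open>On the second separator both heads step back, onto the last letter of
    \<open>v\<close> and of its saved copy; if \<open>v\<close> is empty, onto the first separator
    and a blank.\<close>
  moreover have "runs 1 (dup_config x 1 (int (length (?a @ v))) v ?l (?a @ v))
      (dup_config x 2 (int (length (?a @ v)) - 1) v (?l - 1) ?o)"
    using tape_content_nth[of "?a @ v" Hash w] tape_content_snoc[of "?a @ v" Hash]
    by (intro runs_1)
      (simp add: x dup_config_def dup_tm_def tape_content_Blank fun_upd_idem add_ac)
  moreover have "runs (length v * (2 * length v + 2))
      (dup_config x 2 (int (length (?a @ v)) - 1) v (?l - 1) ?o)
      (dup_config x 2 (int (length ?a) - 1) v (?l - 1) ?c)"
    using assms by (intro runs_append_copies[of _ _ _ "Hash # w"]) auto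
  \<comment> \<open>State 2 rewinds the second tape once more before it reacts to the separator
    after \<open>u\<close>.\<close>
  moreover have "runs (length v) (dup_config x 2 (int (length ?a) - 1) v (?l - 1) ?c)
      (dup_config x 2 (int (length ?a) - 1) v (- 1) ?c)"
    by (rule runs_rewind_state2[of v v "[]"]) simp
  moreover have "runs 1 (dup_config x 2 (int (length ?a) - 1) v (- 1) ?c)
      (dup_config x 4 (int (length ?a)) v (- 1) ?c)"
    using tape_content_nth[of u Hash "v @ Hash # w"]
    by (intro runs_1) (simp add: x dup_config_def dup_tm_def tape_content_Blank fun_upd_idem)
  moreover have "runs (length v) (dup_config x 4 (int (length ?a)) v (- 1) ?c)
      (dup_config x 4 (int (length (?a @ v))) v (- 1) ?c)"
    using assms by (intro runs_skip_state4[of _ _ _ "Hash # w"]) auto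
  \<comment> \<open>The separator after \<open>v\<close> is read a second time and now closes the
    field of copies.\<close>
  moreover have "runs 1 (dup_config x 4 (int (length (?a @ v))) v (- 1) ?c)
      (dup_config x 5 (int (length ?o)) v (- 1) (?c @ [Hash]))"
    using tape_content_nth[of "?a @ v" Hash w] tape_content_snoc[of ?c Hash]
    by (intro runs_1) (simp add: x dup_config_def dup_tm_def fun_upd_idem add_ac)
  moreover have "runs (length w) (dup_config x 5 (int (length ?o)) v (- 1) (?c @ [Hash]))
      (dup_config x 5 (int (length x)) v (- 1) ((?c @ [Hash]) @ w))"
    using assms by (intro runs_copy_state5) simp
  moreover note runs_first_separator[OF x u]
  ultimately have r: "runs (length u + 1 + (length v + (1 + (length v * (2 * length v + 2) +
      (length v + (1 + (length v + (1 + length w))))))))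
      (dup_config x 0 0 [] 0 []) (dup_config x 5 (int (length x)) v (- 1) ((?c @ [Hash]) @ w))"
    by (blast intro: runs_trans)
  \<comment> \<open>The rounds of the loop contribute the only nonlinear term of the step
    count.\<close>
  have "(length v)\<^sup>2 \<le> (length x)\<^sup>2" using x by (intro power_mono) auto
  then have t: "length u + 1 + (length v + (1 + (length v * (2 * length v + 2) +
      (length v + (1 + (length v + (1 + length w))))))) \<le> 5 + 5 * length x + 2 * (length x)\<^sup>2"
    by (simp add: x algebra_simps power2_eq_square)
  have "step dup_tm (dup_config x 5 (int (length x)) v (- 1) ((?c @ [Hash]) @ w)) = None"
    by (simp add: dup_step_simps)
  from computes_withinI[OF r t this] show ?thesis by simp
qed

section \<open>The reduction as a polynomial-time function\<close>

lemma computes_within_mono: "computes_within M x y s \<Longrightarrow> s \<le> t \<Longrightarrow> computes_within M x y t"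
  unfolding computes_within_def using order_trans by blast

lemma ex_dup_tm_output:
  "\<exists>y. computes_within dup_tm x y (5 + 5 * length x + 2 * (length x)\<^sup>2) \<and>
    (x \<in> conformant_bribery_language E \<longleftrightarrow> y \<in> replacing_voters_language E)"
proof (cases "\<exists>u v w. x = u @ Hash # v @ Hash # w \<and> Hash \<notin> set u \<and> Hash \<notin> set v")
  case True
  then show ?thesis using computes_copies language_iff_copies by blast
next
  case False
  then have "x \<notin> conformant_bribery_language E" "x \<notin> replacing_voters_language E"
    using conformant_bribery_language_separators replacing_voters_language_separators
    by metis+
  moreover have "computes_within dup_tm x x (length x)"
  proof (cases "Hash \<in> set x")
    case True
    then obtain u v where "x = u @ Hash # v" "Hash \<notin> set u"
      using split_list_first by metis
    \<comment> \<open>Another \<open>Hash\<close> in \<open>v\<close> would give the excluded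
      decomposition of \<open>x\<close>.\<close>
    moreover from this False have "Hash \<notin> set v"
      using split_list_first by metis
    ultimately show ?thesis by (rule computes_one_separator)
  qed (rule computes_no_separator)
  then have "computes_within dup_tm x x (5 + 5 * length x + 2 * (length x)\<^sup>2)"
    by (rule computes_within_mono) simp
  ultimately show ?thesis by blast
qed

theorem theorem11:
  fixes E :: voting_rule
  assumes "is_voting_rule E"
  shows "conformant_bribery_language E \<le>\<^sub>p replacing_voters_language E"
proof -
  \<comment> \<open>The map \<open>f\<close> comes by choice from the outputs of one fixed machine
    under one fixed bound.\<close>
  obtain f where f: "\<And>x. computes_within dup_tm x (f x) (5 + 5 * length x + 2 * (length x)\<^sup>2)"
      "\<And>x. x \<in> conformant_bribery_language E \<longleftrightarrow> f x \<in> replacing_voters_language E"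
    using ex_dup_tm_output[of _ E] by metis
  have "poly [:5, 5, 2:] n = 5 + 5 * n + 2 * n\<^sup>2" for n :: nat
    by (simp add: algebra_simps power2_eq_square)
  with f(1) have "computes_within dup_tm x (f x) (poly [:5, 5, 2:] (length x))" for x
    by metis
  then have "poly_time_computable f"
    unfolding poly_time_computable_def using wf_dup_tm by blast
  with f(2) show ?thesis unfolding poly_many_one_reducible_def by blast
qed

end
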